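(* Let $\dot A_k$, $k=1,2$, be closed densely defined symmetric operators with deficiency indices $(1,1)$ in Hilbert spaces $\mathcal H_k$, let $g_\pm^k\in \operatorname{Ker}((\dot A_k)^*\mp iI)$ with $\|g_\pm^k\|=1$, and let $A_k$ be the self-adjoint extension of $\dot A_k$ such that $g_+^k-g_-^k\in \operatorname{Dom}(A_k)$, $k=1,2$. Let $\alpha\in[0,\pi)$, let $$\mathcal L=\operatorname{lin\,span}\left\{\sin\alpha\,(g_+^1-g_-^1)\oplus\cos\alpha\,(g_+^2-g_-^2)\right\}\subset\mathcal H_1\oplus\mathcal H_2,$$ and let $\dot A$ be the symmetric operator with deficiency indices $(1,1)$ obtained by restricting $(\dot A_1\oplus\dot A_2)^*$ to $$\operatorname{Dom}(\dot A)=\operatorname{Dom}(\dot A_1)\oplus\operatorname{Dom}(\dot A_2)\dot+\mathcal L .$$ Then the Weyl–Titchmarsh function $M=M(\dot A,A_1\oplus A_2)$ associated with the pair $(\dot A,A_1\oplus A_2)$ is a convex combination of the Weyl–Titchmarsh functions $M_k=M(\dot A_k,A_k)$ associated with the pairs $(\dot A_k,A_k)$, $k=1,2$, given by $$M(z)=\cos^2\alpha\; M_1(z)+\sin^2\alpha\; M_2(z),\qquad z\in\mathbb C_+.$$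
   Context: $\mathbb C_+$ is the open upper half-plane; $\dot+$ denotes a direct (algebraic) sum. Weyl–Titchmarsh function: let $\dot B$ be a densely defined symmetric operator with deficiency indices $(1,1)$ and $B$ a self-adjoint extension of $\dot B$. Let $h_+\in\operatorname{Ker}((\dot B)^*-iI)$ with $\|h_+\|=1$. The Weyl–Titchmarsh function associated with the pair $(\dot B,B)$ is $$M(\dot B,B)(z)=\left((zB+I)(B-zI)^{-1}h_+,h_+\right),\qquad z\in\mathbb C_+$$ (it does not depend on the choice of the unit vector $h_+$). *)

theory Defs
  imports "HOL-Analysis.Analysis"
begin

class scaleC = scaleR +
  fixes scaleC :: "complex \<Rightarrow> 'a \<Rightarrow> 'a"  (infixr "*\<^sub>C" 75)

text \<open>The inner product is linear in the first argument. Its real part is the inner product of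
  the underlying real space, so the norm is the one induced by \<open>cinner\<close>, and positive
  definiteness is inherited from \<^class>\<open>real_inner\<close>.\<close>

class complex_inner = real_inner + scaleC +
  fixes cinner :: "'a \<Rightarrow> 'a \<Rightarrow> complex"
  assumes scaleC_add_right: "c *\<^sub>C (x + y) = c *\<^sub>C x + c *\<^sub>C y"
    and scaleC_add_left: "(c + d) *\<^sub>C x = c *\<^sub>C x + d *\<^sub>C x"
    and scaleC_scaleC: "c *\<^sub>C (d *\<^sub>C x) = (c * d) *\<^sub>C x"
    and scaleC_one: "1 *\<^sub>C x = x"
    and scaleR_scaleC: "r *\<^sub>R x = complex_of_real r *\<^sub>C x"
    and cinner_commute: "cinner x y = cnj (cinner y x)"
    and cinner_add_left: "cinner (x + y) z = cinner x z + cinner y z"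
    and cinner_scaleC_left: "cinner (c *\<^sub>C x) y = c * cinner x y"
    and inner_eq_Re_cinner: "inner x y = Re (cinner x y)"

class chilbert_space = complex_inner + complete_space

global_interpretation complex_vector:
  vector_space "scaleC :: complex \<Rightarrow> 'a \<Rightarrow> 'a :: complex_inner"
  defines csubspace = complex_vector.subspace
    and cspan = complex_vector.span
    and cdim = complex_vector.dim
  by unfold_locales
    (simp_all add: scaleC_add_right scaleC_add_left scaleC_scaleC scaleC_one)

instantiation prod :: (complex_inner, complex_inner) complex_inner
begin

definition scaleC_prod :: "complex \<Rightarrow> 'a \<times> 'b \<Rightarrow> 'a \<times> 'b" where
  "c *\<^sub>C p = (c *\<^sub>C fst p, c *\<^sub>C snd p)"

definition cinner_prod :: "'a \<times> 'b \<Rightarrow> 'a \<times> 'b \<Rightarrow> complex" where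
  "cinner p q = cinner (fst p) (fst q) + cinner (snd p) (snd q)"

instance
proof
  fix x y z :: "'a \<times> 'b"
  show "cinner x y = cnj (cinner y x)"
    unfolding cinner_prod_def complex_cnj_add by (metis cinner_commute)
qed (simp_all add: scaleC_prod_def cinner_prod_def prod_eq_iff scaleC_add_right scaleC_add_left
    scaleC_scaleC scaleC_one scaleR_scaleC cinner_add_left cinner_scaleC_left
    inner_eq_Re_cinner inner_prod_def algebra_simps)

end

instance prod :: (chilbert_space, chilbert_space) chilbert_space ..

text \<open>An operator is identified with its graph, a set of pairs \<open>(x, Tx)\<close>. Thus \<^const>\<open>Domain\<close> is
  the domain, \<open>\<subseteq>\<close> means extension, \<^const>\<open>closed\<close> means closedness, \<^const>\<open>converse\<close> is the
  inverse, \<^const>\<open>Id\<close> is the identity operator, and \<open>S O T\<close> is the operator product that applies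
  \<open>S\<close> first and \<open>T\<close> second.\<close>

definition linear_operator :: "('a::complex_inner \<times> 'a) set \<Rightarrow> bool" where
  "linear_operator T \<longleftrightarrow> csubspace T \<and> single_valued T"

definition op_apply :: "('a \<times> 'a) set \<Rightarrow> 'a \<Rightarrow> 'a" where
  "op_apply T x = (THE y. (x, y) \<in> T)"

definition op_add :: "('a::plus \<times> 'a) set \<Rightarrow> ('a \<times> 'a) set \<Rightarrow> ('a \<times> 'a) set" where
  "op_add S T = {(x, y + y') |x y y'. (x, y) \<in> S \<and> (x, y') \<in> T}"

definition op_scale :: "complex \<Rightarrow> ('a::scaleC \<times> 'a) set \<Rightarrow> ('a \<times> 'a) set" where
  "op_scale c T = {(x, c *\<^sub>C y) |x y. (x, y) \<in> T}"

definition op_ker :: "('a::zero \<times> 'a) set \<Rightarrow> 'a set" where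
  "op_ker T = {x. (x, 0) \<in> T}"

definition op_restrict :: "('a \<times> 'a) set \<Rightarrow> 'a set \<Rightarrow> ('a \<times> 'a) set" where
  "op_restrict T D = {(x, y). (x, y) \<in> T \<and> x \<in> D}"

definition op_oplus :: "('a \<times> 'a) set \<Rightarrow> ('b \<times> 'b) set \<Rightarrow> (('a \<times> 'b) \<times> ('a \<times> 'b)) set" where
  "op_oplus S T = {((x1, x2), (y1, y2)) |x1 x2 y1 y2. (x1, y1) \<in> S \<and> (x2, y2) \<in> T}"

definition densely_defined :: "('a::topological_space \<times> 'a) set \<Rightarrow> bool" where
  "densely_defined T \<longleftrightarrow> closure (Domain T) = UNIV"

definition adjoint_op :: "('a::complex_inner \<times> 'a) set \<Rightarrow> ('a \<times> 'a) set" where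
  "adjoint_op T = {(y, w). \<forall>(x, v) \<in> T. cinner v y = cinner x w}"

definition symmetric_op :: "('a::complex_inner \<times> 'a) set \<Rightarrow> bool" where
  "symmetric_op T \<longleftrightarrow> linear_operator T \<and> densely_defined T \<and> T \<subseteq> adjoint_op T"

definition self_adjoint_op :: "('a::complex_inner \<times> 'a) set \<Rightarrow> bool" where
  "self_adjoint_op T \<longleftrightarrow> linear_operator T \<and> densely_defined T \<and> adjoint_op T = T"

text \<open>\<open>defect_space T z\<close> is \<open>Ker (T\<^sup>* - z I)\<close>.\<close>

definition defect_space :: "('a::complex_inner \<times> 'a) set \<Rightarrow> complex \<Rightarrow> 'a set" where
  "defect_space T z = op_ker (op_add (adjoint_op T) (op_scale (- z) Id))"

text \<open>\<^const>\<open>cdim\<close> is \<open>0\<close> on infinite-dimensional spaces, so only positive values of these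
  indices are meaningful as such.\<close>

definition deficiency_indices :: "('a::complex_inner \<times> 'a) set \<Rightarrow> nat \<times> nat" where
  "deficiency_indices T = (cdim (defect_space T \<i>), cdim (defect_space T (- \<i>)))"

text \<open>\<open>weyl_operator B z\<close> is \<open>(z B + I) (B - z I)\<inverse>\<close>; for self-adjoint
  \<open>B\<close> and nonreal \<open>z\<close> it is everywhere defined. The choice of the unit vector \<open>h\<close> in
  \<open>weyl_titchmarsh\<close> is immaterial when the deficiency indices of \<open>B\<^sub>0\<close> are \<open>(1, 1)\<close>: two choices
  differ by a scalar of modulus 1.\<close>

definition weyl_operator :: "('a::complex_inner \<times> 'a) set \<Rightarrow> complex \<Rightarrow> ('a \<times> 'a) set" where
  "weyl_operator B z = (op_add B (op_scale (- z) Id))\<inverse> O op_add (op_scale z B) Id"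

definition weyl_titchmarsh ::
  "('a::complex_inner \<times> 'a) set \<Rightarrow> ('a \<times> 'a) set \<Rightarrow> complex \<Rightarrow> complex" where
  "weyl_titchmarsh B\<^sub>0 B z =
    (let h = (SOME h. h \<in> defect_space B\<^sub>0 \<i> \<and> norm h = 1)
     in cinner (op_apply (weyl_operator B z) h) h)"

end

theory Submission
  imports Defs
begin

text \<open>Write \<open>s = sin \<alpha>\<close>, \<open>c = cos \<alpha>\<close>, \<open>E = dA1 \<oplus> dA2\<close> and \<open>S = A1 \<oplus> A2\<close>. On \<open>gp_k - gm_k\<close> the
  operator \<open>A_k\<close> acts as the adjoint of \<open>dA_k\<close>, giving \<open>\<i> (gp_k + gm_k)\<close>. Hence \<open>dA\<close> is
  \<open>E\<close> with one pair \<open>(l, m)\<close> of the graph of \<open>S\<close> adjoined, where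
  \<open>l = (s (gp1 - gm1), c (gp2 - gm2))\<close>. As a densely defined restriction of the self-adjoint
  operator \<open>S\<close> it is symmetric.

  The point is the computation of its defect spaces. Those of \<open>E\<close> are the planes spanned by
  \<open>(gp1, 0), (0, gp2)\<close> and by \<open>(gm1, 0), (0, gm2)\<close>. Adjoining \<open>(l, m)\<close> adds a single
  orthogonality condition (\<open>defect_space_extension\<close>). For the number \<open>\<i>\<close> the condition is
  orthogonality to \<open>m + \<i> l = 2 \<i> (s gp1, c gp2)\<close>, which leaves the line through the unit
  vector \<open>h = (c gp1, - s gp2)\<close> (\<open>orthogonal_in_plane\<close>); \<open>- \<i>\<close> is analogous.

  The operator \<open>(z S + I) (S - z I)\<inverse>\<close> is the orthogonal sum of its counterparts for \<open>A1\<close> and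
  \<open>A2\<close>, so its quadratic form at \<open>h\<close> is \<open>c\<^sup>2 M1 + s\<^sup>2 M2\<close>. That these operators are everywhere
  defined rests on the surjectivity of \<open>B - z I\<close> for self-adjoint \<open>B\<close> and nonreal \<open>z\<close>
  (\<open>self_adjoint_op_resolvent_surj\<close>), which is derived from the projection theorem in a Hilbert
  space. That the quadratic form may be evaluated at \<open>h\<close>, whichever unit vector of the
  defect space the definition picks, is \<open>weyl_titchmarsh_eq\<close>.\<close>

section \<open>Complex inner products\<close>

lemma cinner_scaleC_right: "cinner x (c *\<^sub>C y) = cnj c * cinner x y"
  by (metis cinner_commute cinner_scaleC_left complex_cnj_mult)

lemma cinner_add_right: "cinner x (y + z) = cinner x y + cinner x z"
  by (metis cinner_commute cinner_add_left complex_cnj_add)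

lemma uminus_eq_scaleC: "- x = (- 1) *\<^sub>C (x :: 'a::complex_inner)"
  using complex_vector.scale_minus_left[of 1 x] by simp

lemma cinner_minus_left: "cinner (- x) y = - cinner x y"
  by (subst uminus_eq_scaleC) (simp only: cinner_scaleC_left mult_minus1)

lemma cinner_minus_right: "cinner x (- y) = - cinner x y"
  by (subst uminus_eq_scaleC)
     (simp only: cinner_scaleC_right complex_cnj_minus complex_cnj_one mult_minus1)

lemma cinner_diff_left: "cinner (x - y) z = cinner x z - cinner y z"
  using cinner_add_left[of x "- y" z] by (simp add: cinner_minus_left)

lemma cinner_diff_right: "cinner x (y - z) = cinner x y - cinner x z"
  using cinner_add_right[of x y "- z"] by (simp add: cinner_minus_right)

lemma cinner_zero_left: "cinner 0 y = 0"
  using cinner_diff_left[of y y y] by simp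

lemma cinner_zero_right: "cinner x 0 = 0"
  using cinner_diff_right[of x x x] by simp

lemmas cinner_simps = cinner_scaleC_left cinner_scaleC_right cinner_add_left cinner_add_right
  cinner_minus_left cinner_minus_right cinner_diff_left cinner_diff_right
  cinner_zero_left cinner_zero_right

lemma cinner_self: "cinner x x = complex_of_real ((norm x)\<^sup>2)"
proof -
  have "Im (cinner x x) = 0"
    using cinner_commute[of x x] by (simp add: complex_eq_iff)
  then show ?thesis
    by (simp add: complex_eq_iff power2_norm_eq_inner inner_eq_Re_cinner)
qed

lemma norm_scaleC: "norm (c *\<^sub>C x) = cmod c * norm (x :: 'a::complex_inner)"
proof -
  have "complex_of_real ((norm (c *\<^sub>C x))\<^sup>2) = c * cnj c * complex_of_real ((norm x)\<^sup>2)"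
    by (simp only: cinner_self[symmetric] cinner_simps ac_simps)
  also have "\<dots> = complex_of_real ((cmod c * norm x)\<^sup>2)"
    by (simp only: complex_norm_square[symmetric] power_mult_distrib of_real_mult)
  finally have "(norm (c *\<^sub>C x))\<^sup>2 = (cmod c * norm x)\<^sup>2"
    unfolding of_real_eq_iff .
  then show ?thesis by simp
qed

text \<open>Both coordinates of the complex inner product are real inner products, so its continuity
  and the Cauchy--Schwarz bound on its imaginary part come from the underlying real space.\<close>

lemma Im_cinner: "Im (cinner x y) = inner ((- \<i>) *\<^sub>C x) y"
  by (simp add: inner_eq_Re_cinner cinner_simps)

lemma cinner_eq_inner: "cinner x y = Complex (inner x y) (inner ((- \<i>) *\<^sub>C x) y)"
  by (simp add: complex_eq_iff inner_eq_Re_cinner cinner_simps)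

lemma tendsto_cinner_right:
  assumes "(f \<longlongrightarrow> y) F"
  shows "((\<lambda>n. cinner x (f n)) \<longlongrightarrow> cinner x y) F"
  unfolding cinner_eq_inner by (intro tendsto_Complex tendsto_inner tendsto_const assms)

lemma abs_Im_cinner_le: "\<bar>Im (cinner x y)\<bar> \<le> norm x * norm y"
  using Cauchy_Schwarz_ineq2[of "(- \<i>) *\<^sub>C x" y] by (simp only: Im_cinner norm_scaleC) simp

lemma tendsto_scaleC_right:
  fixes f :: "'b \<Rightarrow> 'a::complex_inner"
  assumes "(f \<longlongrightarrow> y) F"
  shows "((\<lambda>n. c *\<^sub>C f n) \<longlongrightarrow> c *\<^sub>C y) F"
proof -
  have "((\<lambda>n. cmod c * dist (f n) y) \<longlongrightarrow> cmod c * 0) F"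
    by (intro tendsto_mult tendsto_const assms[THEN tendsto_dist_iff[THEN iffD1]])
  then show ?thesis
    by (subst tendsto_dist_iff)
       (simp add: dist_norm norm_scaleC complex_vector.scale_right_diff_distrib[symmetric])
qed

lemma dense_orthogonal_imp_zero:
  fixes w :: "'a::complex_inner"
  assumes "closure D = UNIV" and "\<And>x. x \<in> D \<Longrightarrow> cinner x w = 0"
  shows "w = 0"
proof -
  have "closure D \<subseteq> {x. inner x w = 0}"
    using assms(2) by (intro closure_minimal closed_Collect_eq continuous_intros)
      (auto simp: inner_eq_Re_cinner)
  then have "inner w w = 0" unfolding assms(1) by blast
  then show ?thesis by simp
qed

section \<open>The projection theorem\<close>

text \<open>A minimising sequence for the distance from \<open>p\<close> to \<open>M\<close> is Cauchy by the parallelogram law,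
  because the midpoint of two of its members is again in \<open>M\<close> and therefore not nearer to \<open>p\<close> than
  the infimum.\<close>

lemma nearest_point_exists:
  fixes M :: "'a::{real_inner, complete_space} set"
  assumes "closed M" "subspace M"
  obtains q where "q \<in> M" "\<And>x. x \<in> M \<Longrightarrow> norm (p - q) \<le> norm (p - x)"
proof -
  define d where "d = (INF x\<in>M. (norm (p - x))\<^sup>2)"
  have M: "M \<noteq> {}" using subspace_0[OF assms(2)] by auto
  have bdd: "bdd_below ((\<lambda>x. (norm (p - x))\<^sup>2) ` M)"
    by (rule bdd_belowI2[of _ 0]) simp
  have d_le: "d \<le> (norm (p - x))\<^sup>2" if "x \<in> M" for x
    unfolding d_def by (rule cINF_lower[OF bdd that])
  have "\<exists>x\<in>M. (norm (p - x))\<^sup>2 < d + 1 / real (Suc n)" for n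
  proof -
    have "(INF x\<in>M. (norm (p - x))\<^sup>2) < d + 1 / real (Suc n)"
      unfolding d_def[symmetric] by simp
    then show ?thesis using cINF_less_iff[OF M bdd] by blast
  qed
  then obtain q where qM: "\<And>n. q n \<in> M" and
    q_less: "\<And>n. (norm (p - q n))\<^sup>2 < d + 1 / real (Suc n)"
    by metis
  have q_dist: "(norm (q m - q n))\<^sup>2 \<le> 2 / real (Suc m) + 2 / real (Suc n)" for m n
  proof -
    have "(1/2) *\<^sub>R (q m + q n) \<in> M"
      using assms(2) qM by (intro subspace_scale subspace_add)
    from d_le[OF this] have "d \<le> (norm (p - (1/2) *\<^sub>R (q m + q n)))\<^sup>2" .
    moreover have "(norm (q m - q n))\<^sup>2 + 4 * (norm (p - (1/2) *\<^sub>R (q m + q n)))\<^sup>2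
        = 2 * (norm (p - q m))\<^sup>2 + 2 * (norm (p - q n))\<^sup>2"
      by (simp add: power2_norm_eq_inner inner_simps inner_commute algebra_simps)
    ultimately show ?thesis using q_less[of m] q_less[of n] by simp
  qed
  have "Cauchy q"
  proof (rule metric_CauchyI)
    fix e :: real assume e: "e > 0"
    then obtain N where N: "1 / real (Suc N) < e\<^sup>2 / 4"
      using reals_Archimedean[of "e\<^sup>2 / 4"] by (auto simp: inverse_eq_divide)
    have "dist (q m) (q n) < e" if "m \<ge> N" "n \<ge> N" for m n
    proof -
      have "2 / real (Suc k) < e\<^sup>2 / 2" if "k \<ge> N" for k
      proof -
        have "1 / real (Suc k) \<le> 1 / real (Suc N)"
          using that by (intro divide_left_mono) auto
        then show ?thesis using N by simp
      qed
      from this[OF that(1)] this[OF that(2)] q_dist[of m n]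
      have "(norm (q m - q n))\<^sup>2 < e\<^sup>2" by linarith
      then show ?thesis using e by (simp add: dist_norm power2_less_imp_less)
    qed
    then show "\<exists>N. \<forall>m\<ge>N. \<forall>n\<ge>N. dist (q m) (q n) < e" by blast
  qed
  then obtain l where l: "q \<longlonglongrightarrow> l" by (meson Cauchy_convergent convergent_def)
  have lM: "l \<in> M" using closed_sequentially[OF assms(1)] qM l by blast
  have "(norm (p - l))\<^sup>2 \<le> d + 0"
  proof (rule LIMSEQ_le)
    show "(\<lambda>n. (norm (p - q n))\<^sup>2) \<longlonglongrightarrow> (norm (p - l))\<^sup>2" by (intro tendsto_intros l)
    show "(\<lambda>n. d + 1 / real (Suc n)) \<longlonglongrightarrow> d + 0"
      using LIMSEQ_inverse_real_of_nat by (intro tendsto_intros) (simp add: inverse_eq_divide)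
    show "\<exists>N. \<forall>n\<ge>N. (norm (p - q n))\<^sup>2 \<le> d + 1 / real (Suc n)"
      using q_less less_imp_le by blast
  qed
  then have "norm (p - l) \<le> norm (p - x)" if "x \<in> M" for x
    using d_le[OF that] by (simp add: power2_le_imp_le)
  then show ?thesis using that lM by blast
qed

text \<open>The difference between \<open>p\<close> and its nearest point is orthogonal to \<open>M\<close> for the real inner
  product. Since \<open>M\<close> is stable under multiplication by the imaginary unit, it is orthogonal for
  the complex one as well.\<close>

lemma closed_csubspace_orthogonal_vector:
  fixes M :: "'a::chilbert_space set"
  assumes "closed M" "csubspace M" "p \<notin> M"
  obtains w where "w \<noteq> 0" "\<And>x. x \<in> M \<Longrightarrow> cinner x w = 0"
proof -
  have sub: "subspace M"
    using assms(2) by (auto simp: subspace_def complex_vector.subspace_def scaleR_scaleC)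
  obtain q where qM: "q \<in> M" and q: "\<And>x. x \<in> M \<Longrightarrow> norm (p - q) \<le> norm (p - x)"
    using nearest_point_exists[OF assms(1) sub] by metis
  define w where "w = p - q"
  have real_orth: "inner x w = 0" if x: "x \<in> M" for x
  proof (cases "x = 0")
    case False
    \<comment> \<open>\<open>t\<close> minimises the distance from \<open>w\<close> to the line spanned by \<open>x\<close>.\<close>
    define t where "t = inner x w / inner x x"
    have xx: "inner x x > 0" using False by simp
    have "q + t *\<^sub>R x \<in> M" using sub qM x by (intro subspace_add subspace_scale)
    from q[OF this] have "norm w \<le> norm (w - t *\<^sub>R x)" by (simp add: w_def algebra_simps)
    then have "(norm w)\<^sup>2 \<le> (norm (w - t *\<^sub>R x))\<^sup>2" by (intro power_mono) auto
    also have "\<dots> = (norm w)\<^sup>2 - 2 * t * inner x w + t * (t * inner x x)"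
      by (simp add: power2_norm_eq_inner inner_simps inner_commute algebra_simps)
    also have "t * inner x x = inner x w" using xx by (simp add: t_def)
    finally have "t * inner x w \<le> 0" by simp
    then have "(inner x w)\<^sup>2 \<le> 0"
      using xx by (simp add: t_def power2_eq_square divide_le_0_iff)
    then show ?thesis by simp
  qed simp
  have "cinner x w = 0" if "x \<in> M" for x
    unfolding cinner_eq_inner
    using real_orth that complex_vector.subspace_scale[OF assms(2) that]
    by (simp add: complex_eq_iff)
  moreover have "w \<noteq> 0" using qM assms(3) by (auto simp: w_def)
  ultimately show ?thesis using that by blast
qed

section \<open>Adjoints and self-adjoint operators\<close>

lemma mem_adjoint_op_iff:
  "(y, w) \<in> adjoint_op T \<longleftrightarrow> (\<forall>x v. (x, v) \<in> T \<longrightarrow> cinner v y = cinner x w)"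
  by (auto simp: adjoint_op_def)

lemma adjoint_op_antimono: "S \<subseteq> T \<Longrightarrow> adjoint_op T \<subseteq> adjoint_op S"
  by (auto simp: adjoint_op_def)

lemma mem_defect_space_iff: "x \<in> defect_space T z \<longleftrightarrow> (x, z *\<^sub>C x) \<in> adjoint_op T"
  by (auto simp: defect_space_def op_ker_def op_add_def op_scale_def
      complex_vector.scale_minus_left)

lemma single_valued_adjoint_op:
  assumes "densely_defined T"
  shows "single_valued (adjoint_op T)"
proof (rule single_valuedI)
  fix y w w' assume "(y, w) \<in> adjoint_op T" "(y, w') \<in> adjoint_op T"
  then have "cinner x (w - w') = 0" if "x \<in> Domain T" for x
    using that by (fastforce simp: mem_adjoint_op_iff cinner_simps)
  then have "w - w' = 0"
    using assms unfolding densely_defined_def by (rule dense_orthogonal_imp_zero[rotated])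
  then show "w = w'" by simp
qed

lemma csubspace_pairs:
  assumes "csubspace T"
  shows "(0, 0) \<in> T"
    and "(x, y) \<in> T \<Longrightarrow> (x', y') \<in> T \<Longrightarrow> (x + x', y + y') \<in> T"
    and "(x, y) \<in> T \<Longrightarrow> (c *\<^sub>C x, c *\<^sub>C y) \<in> T"
proof -
  show "(0, 0) \<in> T"
    using complex_vector.subspace_0[OF assms] by (simp add: zero_prod_def)
  show "(x + x', y + y') \<in> T" if "(x, y) \<in> T" "(x', y') \<in> T"
    using complex_vector.subspace_add[OF assms that] by simp
  show "(c *\<^sub>C x, c *\<^sub>C y) \<in> T" if "(x, y) \<in> T"
    using complex_vector.subspace_scale[OF assms that, of c] by (simp add: scaleC_prod_def)
qed

lemma csubspace_adjoint_op: "csubspace (adjoint_op T)"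
  by (auto simp: complex_vector.subspace_def mem_adjoint_op_iff cinner_simps scaleC_prod_def
      zero_prod_def)

lemma csubspace_Domain: "csubspace T \<Longrightarrow> csubspace (Domain T)"
  unfolding complex_vector.subspace_def[of "Domain T"] Domain_iff
  by (blast intro: csubspace_pairs)

lemma self_adjoint_op_symmetric:
  assumes "self_adjoint_op B" "(x, v) \<in> B" "(y, w) \<in> B"
  shows "cinner v y = cinner x w"
  using assms by (metis mem_adjoint_op_iff self_adjoint_op_def)

text \<open>The quadratic form of a self-adjoint operator is real, so the imaginary part of
  \<open>((B - z) u, u)\<close> is exactly \<open>- Im z * (norm u)\<^sup>2\<close>. This makes \<open>B - z\<close> bounded below.\<close>

lemma self_adjoint_op_bounded_below:
  assumes "self_adjoint_op B" "(u, v) \<in> B"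
  shows "\<bar>Im z\<bar> * norm u \<le> norm (v - z *\<^sub>C u)"
proof (cases "u = 0")
  case False
  have "cinner v u = cnj (cinner v u)"
    using self_adjoint_op_symmetric[OF assms(1,2,2)] cinner_commute by metis
  then have "Im (cinner v u) = 0" by (simp add: complex_eq_iff)
  then have "\<bar>Im (cinner (v - z *\<^sub>C u) u)\<bar> = \<bar>Im z\<bar> * (norm u)\<^sup>2"
    by (simp add: cinner_simps cinner_self abs_mult)
  then have "\<bar>Im z\<bar> * norm u * norm u \<le> norm (v - z *\<^sub>C u) * norm u"
    using abs_Im_cinner_le[of "v - z *\<^sub>C u" u] by (simp add: power2_eq_square mult.assoc)
  then show ?thesis using False by simp
qed simp

text \<open>The lower bound makes the range of \<open>B - z\<close> closed. A vector orthogonal to it would be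
  an eigenvector of the adjoint, that is of \<open>B\<close>, for the nonreal number \<open>cnj z\<close>, which
  the lower bound also excludes.\<close>

lemma self_adjoint_op_resolvent_surj:
  fixes B :: "('a::chilbert_space \<times> 'a) set"
  assumes B: "self_adjoint_op B" and z: "Im z \<noteq> 0"
  obtains u v where "(u, v) \<in> B" "f = v - z *\<^sub>C u"
proof -
  have lin: "csubspace B" and adj: "adjoint_op B = B"
    using B by (auto simp: self_adjoint_op_def linear_operator_def)
  define R where "R = {v - z *\<^sub>C u |u v. (u, v) \<in> B}"
  have subR: "csubspace R"
    unfolding complex_vector.subspace_def
  proof (intro conjI ballI allI)
    have "(0 :: 'a) = 0 - z *\<^sub>C 0" by simp
    then show "0 \<in> R" using csubspace_pairs(1)[OF lin] unfolding R_def by blast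
  next
    fix x y assume "x \<in> R" "y \<in> R"
    then obtain u v u' v' where "(u, v) \<in> B" "x = v - z *\<^sub>C u" "(u', v') \<in> B" "y = v' - z *\<^sub>C u'"
      by (auto simp: R_def)
    then have "(u + u', v + v') \<in> B" "x + y = (v + v') - z *\<^sub>C (u + u')"
      using csubspace_pairs(2)[OF lin] by (auto simp: scaleC_add_right)
    then show "x + y \<in> R" unfolding R_def by blast
  next
    fix c x assume "x \<in> R"
    then obtain u v where "(u, v) \<in> B" "x = v - z *\<^sub>C u"
      by (auto simp: R_def)
    then have "(c *\<^sub>C u, c *\<^sub>C v) \<in> B" "c *\<^sub>C x = c *\<^sub>C v - z *\<^sub>C (c *\<^sub>C u)"
      using csubspace_pairs(3)[OF lin]
      by (auto simp: complex_vector.scale_right_diff_distrib scaleC_scaleC mult.commute)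
    then show "c *\<^sub>C x \<in> R" unfolding R_def by blast
  qed
  have "closed R"
    unfolding closed_sequential_limits
  proof (intro allI impI, elim conjE)
    fix r l assume rR: "\<forall>n. r n \<in> R" and r: "r \<longlonglongrightarrow> l"
    from rR have "\<forall>n. \<exists>u v. (u, v) \<in> B \<and> r n = v - z *\<^sub>C u" unfolding R_def by blast
    then obtain u v where uv: "\<And>n. (u n, v n) \<in> B" and rn: "\<And>n. r n = v n - z *\<^sub>C u n"
      by metis
    have dist_u: "\<bar>Im z\<bar> * dist (u m) (u n) \<le> dist (r m) (r n)" for m n
    proof -
      have "(u m - u n, v m - v n) \<in> B"
        using complex_vector.subspace_diff[OF lin uv[of m] uv[of n]] by simp
      from self_adjoint_op_bounded_below[OF B this, of z] show ?thesis
        by (simp add: dist_norm rn complex_vector.scale_right_diff_distrib algebra_simps)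
    qed
    have "Cauchy u"
    proof (rule metric_CauchyI)
      fix e :: real assume "e > 0"
      then have "\<bar>Im z\<bar> * e > 0" using z by simp
      then obtain N where "\<forall>m\<ge>N. \<forall>n\<ge>N. dist (r m) (r n) < \<bar>Im z\<bar> * e"
        using LIMSEQ_imp_Cauchy[OF r] unfolding Cauchy_def by blast
      then have "\<forall>m\<ge>N. \<forall>n\<ge>N. \<bar>Im z\<bar> * dist (u m) (u n) < \<bar>Im z\<bar> * e"
        using dist_u by (meson le_less_trans)
      then show "\<exists>N. \<forall>m\<ge>N. \<forall>n\<ge>N. dist (u m) (u n) < e"
        using z by (auto simp: mult_less_cancel_left_pos)
    qed
    then obtain a where a: "u \<longlonglongrightarrow> a" by (meson Cauchy_convergent convergent_def)
    have "(\<lambda>n. r n + z *\<^sub>C u n) \<longlonglongrightarrow> l + z *\<^sub>C a"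
      by (intro tendsto_add tendsto_scaleC_right r a)
    then have v: "v \<longlonglongrightarrow> l + z *\<^sub>C a" by (simp add: rn)
    have "cinner y a = cinner x (l + z *\<^sub>C a)" if "(x, y) \<in> B" for x y
    proof (rule LIMSEQ_unique)
      show "(\<lambda>n. cinner y (u n)) \<longlonglongrightarrow> cinner y a" by (rule tendsto_cinner_right[OF a])
      show "(\<lambda>n. cinner y (u n)) \<longlonglongrightarrow> cinner x (l + z *\<^sub>C a)"
        using tendsto_cinner_right[OF v, of x] self_adjoint_op_symmetric[OF B that uv] by simp
    qed
    then have "(a, l + z *\<^sub>C a) \<in> adjoint_op B" by (simp add: mem_adjoint_op_iff)
    then have "(a, l + z *\<^sub>C a) \<in> B" by (simp add: adj)
    moreover have "l = (l + z *\<^sub>C a) - z *\<^sub>C a" by simp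
    ultimately show "l \<in> R" unfolding R_def by blast
  qed
  have "f \<in> R"
  proof (rule ccontr)
    assume "f \<notin> R"
    then obtain w where w: "w \<noteq> 0" "\<And>x. x \<in> R \<Longrightarrow> cinner x w = 0"
      using closed_csubspace_orthogonal_vector[OF \<open>closed R\<close> subR] by metis
    have "cinner v w = cinner u (cnj z *\<^sub>C w)" if "(u, v) \<in> B" for u v
    proof -
      have "v - z *\<^sub>C u \<in> R" using that by (auto simp: R_def)
      from w(2)[OF this] show ?thesis by (simp add: cinner_simps)
    qed
    then have "(w, cnj z *\<^sub>C w) \<in> adjoint_op B" by (simp add: mem_adjoint_op_iff)
    then have "(w, cnj z *\<^sub>C w) \<in> B" by (simp add: adj)
    from self_adjoint_op_bounded_below[OF B this, of "cnj z"] show False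
      using w(1) z by (simp add: mult_le_0_iff)
  qed
  then show ?thesis using that by (auto simp: R_def)
qed

section \<open>Weyl--Titchmarsh functions\<close>

lemma mem_weyl_operator_iff:
  assumes "single_valued B"
  shows "(f, g) \<in> weyl_operator B z \<longleftrightarrow>
    (\<exists>u v. (u, v) \<in> B \<and> f = v - z *\<^sub>C u \<and> g = z *\<^sub>C v + u)"
proof -
  have "(f, g) \<in> weyl_operator B z \<longleftrightarrow>
    (\<exists>u v v'. (u, v) \<in> B \<and> (u, v') \<in> B \<and> f = v - z *\<^sub>C u \<and> g = z *\<^sub>C v' + u)"
    by (auto simp: weyl_operator_def op_add_def op_scale_def relcomp_unfold
        complex_vector.scale_minus_left)
  then show ?thesis using assms by (metis single_valuedD)
qed

lemma weyl_operator_total: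
  fixes B :: "('a::chilbert_space \<times> 'a) set"
  assumes "self_adjoint_op B" "Im z \<noteq> 0"
  obtains g where "(f, g) \<in> weyl_operator B z"
proof -
  obtain u v where "(u, v) \<in> B" "f = v - z *\<^sub>C u"
    using self_adjoint_op_resolvent_surj[OF assms] .
  then show ?thesis
    using assms that by (auto simp: mem_weyl_operator_iff self_adjoint_op_def linear_operator_def)
qed

lemma single_valued_weyl_operator:
  assumes B: "self_adjoint_op B" and z: "Im z \<noteq> 0"
  shows "single_valued (weyl_operator B z)"
proof (rule single_valuedI)
  have lin: "csubspace B" and sv: "single_valued B"
    using B by (auto simp: self_adjoint_op_def linear_operator_def)
  fix f g g' assume "(f, g) \<in> weyl_operator B z" "(f, g') \<in> weyl_operator B z"
  then obtain u v u' v' where uv: "(u, v) \<in> B" "f = v - z *\<^sub>C u" "g = z *\<^sub>C v + u"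
    and uv': "(u', v') \<in> B" "f = v' - z *\<^sub>C u'" "g' = z *\<^sub>C v' + u'"
    using mem_weyl_operator_iff[OF sv] by metis
  have "(u - u', v - v') \<in> B"
    using complex_vector.subspace_diff[OF lin uv(1) uv'(1)] by simp
  from self_adjoint_op_bounded_below[OF B this, of z]
  have "\<bar>Im z\<bar> * norm (u - u') \<le> norm (f - f)"
    unfolding complex_vector.scale_right_diff_distrib uv'(2) using uv(2) uv'(2)
    by (simp add: algebra_simps)
  then have "u = u'" using z by (simp add: mult_le_0_iff)
  then show "g = g'" using uv uv' sv by (auto dest: single_valuedD)
qed

lemma weyl_operator_scaleC:
  assumes B: "linear_operator B" and fg: "(f, g) \<in> weyl_operator B z"
  shows "(c *\<^sub>C f, c *\<^sub>C g) \<in> weyl_operator B z"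
proof -
  have lin: "csubspace B" and sv: "single_valued B"
    using B by (auto simp: linear_operator_def)
  obtain u v where "(u, v) \<in> B" "f = v - z *\<^sub>C u" "g = z *\<^sub>C v + u"
    using fg mem_weyl_operator_iff[OF sv] by metis
  then have "(c *\<^sub>C u, c *\<^sub>C v) \<in> B" "c *\<^sub>C f = c *\<^sub>C v - z *\<^sub>C c *\<^sub>C u"
    "c *\<^sub>C g = z *\<^sub>C c *\<^sub>C v + c *\<^sub>C u"
    using csubspace_pairs(3)[OF lin]
    by (auto simp: complex_vector.scale_right_diff_distrib scaleC_add_right scaleC_scaleC
        mult.commute)
  then show ?thesis using mem_weyl_operator_iff[OF sv] by metis
qed

lemma op_apply_eq: "single_valued T \<Longrightarrow> (x, y) \<in> T \<Longrightarrow> op_apply T x = y"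
  unfolding op_apply_def by (auto dest: single_valuedD)

text \<open>Unit vectors of a one-dimensional defect space differ by a scalar of modulus one, which
  cancels from the quadratic form. Any unit vector of the defect space can therefore replace the
  chosen one.\<close>

lemma weyl_titchmarsh_eq:
  assumes B: "self_adjoint_op B" and z: "Im z \<noteq> 0"
    and defect: "defect_space B\<^sub>0 \<i> = cspan {h}" and h: "norm h = 1"
    and hk: "(h, k) \<in> weyl_operator B z"
  shows "weyl_titchmarsh B\<^sub>0 B z = cinner k h"
proof -
  define h' where "h' = (SOME h. h \<in> defect_space B\<^sub>0 \<i> \<and> norm h = 1)"
  have "h \<in> defect_space B\<^sub>0 \<i> \<and> norm h = 1"
    using h by (simp add: defect complex_vector.span_base)
  then have h': "h' \<in> cspan {h}" "norm h' = 1"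
    unfolding h'_def defect[symmetric] by (metis (mono_tags, lifting) someI)+
  then obtain c where c: "h' = c *\<^sub>C h" by (auto simp: complex_vector.span_singleton)
  then have "cmod c = 1" using h h'(2) by (simp add: norm_scaleC)
  then have cc: "c * cnj c = 1" by (simp add: complex_norm_square[symmetric])
  have lin: "linear_operator B" using B by (simp add: self_adjoint_op_def)
  have "op_apply (weyl_operator B z) h' = c *\<^sub>C k"
    unfolding c
    by (intro op_apply_eq single_valued_weyl_operator[OF B z]
        weyl_operator_scaleC[OF lin hk])
  then have "weyl_titchmarsh B\<^sub>0 B z = cinner (c *\<^sub>C k) (c *\<^sub>C h)"
    by (simp add: weyl_titchmarsh_def h'_def[symmetric] c)
  also have "\<dots> = (c * cnj c) * cinner k h" by (simp add: cinner_simps)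
  finally show ?thesis using cc by simp
qed

section \<open>Orthogonal sums of operators\<close>

lemma mem_op_oplus_iff:
  "((x1, x2), (y1, y2)) \<in> op_oplus S T \<longleftrightarrow> (x1, y1) \<in> S \<and> (x2, y2) \<in> T"
  by (auto simp: op_oplus_def)

lemma Domain_op_oplus: "Domain (op_oplus S T) = Domain S \<times> Domain T"
  unfolding op_oplus_def by blast

lemma op_oplus_mono: "S \<subseteq> S' \<Longrightarrow> T \<subseteq> T' \<Longrightarrow> op_oplus S T \<subseteq> op_oplus S' T'"
  by (auto simp: op_oplus_def)

lemma linear_operator_op_oplus:
  assumes "linear_operator S" "linear_operator T"
  shows "linear_operator (op_oplus S T)"
  unfolding linear_operator_def
proof
  have S: "csubspace S" and T: "csubspace T"
    using assms by (auto simp: linear_operator_def)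
  show "csubspace (op_oplus S T)"
    using csubspace_pairs[OF S] csubspace_pairs[OF T]
    by (auto simp: complex_vector.subspace_def scaleC_prod_def mem_op_oplus_iff zero_prod_def)
  show "single_valued (op_oplus S T)"
    using assms by (auto simp: linear_operator_def single_valued_def mem_op_oplus_iff)
qed

lemma densely_defined_op_oplus:
  "densely_defined S \<Longrightarrow> densely_defined T \<Longrightarrow> densely_defined (op_oplus S T)"
  by (simp add: densely_defined_def Domain_op_oplus closure_Times)

lemma adjoint_op_oplus:
  assumes "csubspace S" "csubspace T"
  shows "adjoint_op (op_oplus S T) = op_oplus (adjoint_op S) (adjoint_op T)"
proof -
  have "((y1, y2), (w1, w2)) \<in> adjoint_op (op_oplus S T) \<longleftrightarrow>
      (y1, w1) \<in> adjoint_op S \<and> (y2, w2) \<in> adjoint_op T" for y1 y2 w1 w2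
  proof
    assume *: "((y1, y2), (w1, w2)) \<in> adjoint_op (op_oplus S T)"
    have "cinner v1 y1 + cinner v2 y2 = cinner x1 w1 + cinner x2 w2"
      if "(x1, v1) \<in> S" "(x2, v2) \<in> T" for x1 v1 x2 v2
      using *[unfolded mem_adjoint_op_iff, rule_format, of "(x1, x2)" "(v1, v2)"] that
      by (simp add: mem_op_oplus_iff cinner_prod_def)
    from this[OF _ csubspace_pairs(1)[OF assms(2)]] this[OF csubspace_pairs(1)[OF assms(1)]]
    show "(y1, w1) \<in> adjoint_op S \<and> (y2, w2) \<in> adjoint_op T"
      by (simp add: mem_adjoint_op_iff cinner_simps)
  qed (auto simp: mem_adjoint_op_iff mem_op_oplus_iff cinner_prod_def)
  then show ?thesis by (auto simp: mem_op_oplus_iff)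
qed

lemma self_adjoint_op_oplus:
  "self_adjoint_op S \<Longrightarrow> self_adjoint_op T \<Longrightarrow> self_adjoint_op (op_oplus S T)"
  by (simp add: self_adjoint_op_def linear_operator_op_oplus densely_defined_op_oplus)
     (simp add: linear_operator_def adjoint_op_oplus)

lemma defect_space_op_oplus:
  assumes "csubspace S" "csubspace T"
  shows "defect_space (op_oplus S T) z = defect_space S z \<times> defect_space T z"
  by (auto simp: mem_defect_space_iff adjoint_op_oplus[OF assms] scaleC_prod_def mem_op_oplus_iff)

lemma weyl_operator_op_oplus:
  assumes "single_valued S" "single_valued T"
    and "(f1, g1) \<in> weyl_operator S z" "(f2, g2) \<in> weyl_operator T z"
  shows "((f1, f2), (g1, g2)) \<in> weyl_operator (op_oplus S T) z"
proof -
  have sv: "single_valued (op_oplus S T)"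
    using assms(1,2) by (auto simp: single_valued_def mem_op_oplus_iff)
  obtain u1 v1 u2 v2 where "(u1, v1) \<in> S" "f1 = v1 - z *\<^sub>C u1" "g1 = z *\<^sub>C v1 + u1"
    "(u2, v2) \<in> T" "f2 = v2 - z *\<^sub>C u2" "g2 = z *\<^sub>C v2 + u2"
    using assms by (metis mem_weyl_operator_iff)
  then show ?thesis
    unfolding mem_weyl_operator_iff[OF sv]
    by (intro exI[of _ "(u1, u2)"] exI[of _ "(v1, v2)"])
       (simp add: mem_op_oplus_iff scaleC_prod_def)
qed

section \<open>Defect spaces\<close>

lemma cdim_one_eq_cspan:
  assumes V: "csubspace V" and dim: "cdim V = 1" and h: "h \<in> V" "h \<noteq> 0"
  shows "V = cspan {h}"
proof
  obtain b where b: "V \<subseteq> cspan {b}"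
    using complex_vector.basis_exists[of V] dim by (metis card_1_singletonE)
  then obtain k where k: "h = k *\<^sub>C b"
    using h(1) by (auto simp: complex_vector.span_singleton)
  then have "k \<noteq> 0" using h(2) by auto
  then have "b = inverse k *\<^sub>C h" by (simp add: k)
  then have "b \<in> cspan {h}" unfolding complex_vector.span_singleton by blast
  then have "cspan {b} \<subseteq> cspan {h}"
    by (intro complex_vector.span_minimal complex_vector.subspace_span) auto
  then show "V \<subseteq> cspan {h}" using b by blast
  show "cspan {h} \<subseteq> V" using h(1) V by (intro complex_vector.span_minimal) auto
qed

lemma cdim_cspan_singleton:
  assumes "h \<noteq> 0"
  shows "cdim (cspan {h}) = 1"
  using assms by (simp add: complex_vector.dim_span complex_vector.dim_eq_card_independent
      complex_vector.dependent_single)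

lemma csubspace_defect_space: "csubspace (defect_space T z)"
  unfolding complex_vector.subspace_def
proof (intro conjI ballI allI)
  note adj = csubspace_pairs[OF csubspace_adjoint_op[of T]]
  show "0 \<in> defect_space T z" using adj(1) by (simp add: mem_defect_space_iff)
  show "x + y \<in> defect_space T z" if "x \<in> defect_space T z" "y \<in> defect_space T z" for x y
    using adj(2) that by (simp add: mem_defect_space_iff scaleC_add_right)
  show "c *\<^sub>C x \<in> defect_space T z" if "x \<in> defect_space T z" for c x
    using adj(3)[of x "z *\<^sub>C x" c] that
    by (simp only: mem_defect_space_iff scaleC_scaleC mult.commute)
qed

lemma defect_space_eq_cspan:
  assumes "deficiency_indices T = (1, 1)" "norm h = 1" "h \<in> defect_space T z" "z = \<i> \<or> z = - \<i>"
  shows "defect_space T z = cspan {h}"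
  using assms by (intro cdim_one_eq_cspan csubspace_defect_space)
    (auto simp: deficiency_indices_def)

text \<open>Adjoining one pair \<open>(l, m)\<close> to the graph of an operator imposes one linear condition
  on its adjoint.\<close>

lemma defect_space_extension:
  assumes "csubspace E"
  shows "defect_space {e + c *\<^sub>C (l, m) |e c. e \<in> E} z =
    {h \<in> defect_space E z. cinner (m - cnj z *\<^sub>C l) h = 0}" (is "defect_space ?T z = _")
proof -
  have 1: "E \<subseteq> ?T"
  proof
    fix e assume "e \<in> E"
    moreover have "e = e + 0 *\<^sub>C (l, m)" by simp
    ultimately show "e \<in> ?T" by blast
  qed
  have "(l, m) = 0 + 1 *\<^sub>C (l, m)" by (simp add: scaleC_one)
  then have 2: "(l, m) \<in> ?T"
    using complex_vector.subspace_0[OF assms] by blast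
  have "(y, w) \<in> adjoint_op ?T \<longleftrightarrow> (y, w) \<in> adjoint_op E \<and> cinner m y = cinner l w" for y w
  proof
    assume "(y, w) \<in> adjoint_op ?T"
    then show "(y, w) \<in> adjoint_op E \<and> cinner m y = cinner l w"
      using 1 2 adjoint_op_antimono by (meson mem_adjoint_op_iff subsetD)
  next
    assume *: "(y, w) \<in> adjoint_op E \<and> cinner m y = cinner l w"
    show "(y, w) \<in> adjoint_op ?T"
      unfolding mem_adjoint_op_iff
    proof (intro allI impI)
      fix x v assume "(x, v) \<in> ?T"
      then obtain a b c where "(a, b) \<in> E" "x = a + c *\<^sub>C l" "v = b + c *\<^sub>C m"
        by (auto simp: scaleC_prod_def)
      then show "cinner v y = cinner x w"
        using * by (simp add: mem_adjoint_op_iff cinner_simps)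
    qed
  qed
  then show ?thesis by (auto simp: mem_defect_space_iff cinner_simps)
qed

text \<open>In the plane spanned by \<open>(g1, 0)\<close> and \<open>(0, g2)\<close> the vectors orthogonal to \<open>(s g1, c g2)\<close>
  form a line, obtained by a quarter turn.\<close>

lemma orthogonal_in_plane:
  fixes s c :: real
  assumes "norm g1 = 1" "norm g2 = 1" "s\<^sup>2 + c\<^sup>2 = 1"
  shows "{h \<in> cspan {g1} \<times> cspan {g2}.
      cinner (complex_of_real s *\<^sub>C g1, complex_of_real c *\<^sub>C g2) h = 0} =
    cspan {(complex_of_real c *\<^sub>C g1, - (complex_of_real s *\<^sub>C g2))}" (is "?L = cspan {?h}")
proof (intro equalityI subsetI)
  have sc: "complex_of_real s * complex_of_real s + complex_of_real c * complex_of_real c = 1"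
    using assms(3) by (simp only: of_real_mult[symmetric] of_real_add[symmetric] power2_eq_square) simp
  fix h assume "h \<in> ?L"
  then obtain a b where h: "h = (a *\<^sub>C g1, b *\<^sub>C g2)"
    unfolding complex_vector.span_singleton by blast
  have orth: "complex_of_real s * cnj a + complex_of_real c * cnj b = 0"
    using \<open>h \<in> ?L\<close> assms(1,2)
    by (simp add: h cinner_prod_def cinner_simps cinner_self mult.commute)
  from orth have "cnj (complex_of_real s * cnj a + complex_of_real c * cnj b) = 0" by simp
  then have orth': "complex_of_real s * a + complex_of_real c * b = 0" by simp
  \<comment> \<open>the coefficient of \<open>h\<close> along the unit vector on the right\<close>
  define t where "t = complex_of_real c * a - complex_of_real s * b"
  have "t * complex_of_real c = a" "t * complex_of_real s = - b"
    using sc orth' unfolding t_def by algebra+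
  then have "h = t *\<^sub>C ?h"
    by (simp add: h scaleC_prod_def scaleC_scaleC complex_vector.scale_minus_right
        complex_vector.scale_minus_left)
  then show "h \<in> cspan {?h}" by (auto simp: complex_vector.span_singleton)
next
  fix h assume "h \<in> cspan {?h}"
  then obtain t where "h = t *\<^sub>C ?h" by (auto simp: complex_vector.span_singleton)
  then have h': "h = ((t * c) *\<^sub>C g1, (- t * s) *\<^sub>C g2)"
    by (simp add: scaleC_prod_def)
  then have "h \<in> cspan {g1} \<times> cspan {g2}"
    unfolding complex_vector.span_singleton by blast
  then show "h \<in> ?L"
    using assms(1,2) by (simp add: h' cinner_prod_def cinner_simps cinner_self)
qed

section \<open>One-dimensional symmetric extensions\<close>

text \<open>The adjoint multiplies \<open>gp\<close> by \<open>\<i>\<close> and \<open>gm\<close> by \<open>- \<i>\<close>, so the minus sign in \<open>gp - gm\<close>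
  becomes a plus sign. Since self-adjoint extensions of \<open>T\<close> are restrictions of its adjoint, they
  act in the same way.\<close>

lemma defect_difference_in_adjoint:
  assumes "gp \<in> defect_space T \<i>" "gm \<in> defect_space T (- \<i>)"
  shows "(gp - gm, \<i> *\<^sub>C (gp + gm)) \<in> adjoint_op T"
proof -
  have "(gp, \<i> *\<^sub>C gp) - (gm, (- \<i>) *\<^sub>C gm) \<in> adjoint_op T"
    using assms unfolding mem_defect_space_iff
    by (intro complex_vector.subspace_diff csubspace_adjoint_op)
  then show ?thesis
    by (simp add: complex_vector.scale_minus_left scaleC_add_right)
qed

lemma defect_difference_in_extension:
  assumes A: "self_adjoint_op A" and T: "T \<subseteq> A" "densely_defined T"
    and g: "gp \<in> defect_space T \<i>" "gm \<in> defect_space T (- \<i>)" "gp - gm \<in> Domain A"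
  shows "(gp - gm, \<i> *\<^sub>C (gp + gm)) \<in> A"
proof -
  obtain v where v: "(gp - gm, v) \<in> A" using g(3) by blast
  have "A \<subseteq> adjoint_op T"
    using A adjoint_op_antimono[OF T(1)] by (simp add: self_adjoint_op_def)
  then have "v = \<i> *\<^sub>C (gp + gm)"
    using v defect_difference_in_adjoint[OF g(1,2)] single_valued_adjoint_op[OF T(2)]
    by (meson single_valuedD subsetD)
  then show ?thesis using v by simp
qed

text \<open>If \<open>gp - gm\<close> were in the domain of \<open>T\<close>, then pairing \<open>T (gp - gm)\<close> with \<open>gp\<close>, which
  solves \<open>T\<^sup>* gp = \<i> gp\<close>, would give \<open>2 * \<i> * (norm gp)\<^sup>2 = 0\<close>.\<close>

lemma defect_difference_notin_Domain:
  assumes T: "symmetric_op T"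
    and g: "gp \<in> defect_space T \<i>" "gm \<in> defect_space T (- \<i>)" "gp \<noteq> 0"
  shows "gp - gm \<notin> Domain T"
proof
  assume "gp - gm \<in> Domain T"
  then obtain v where v: "(gp - gm, v) \<in> T" by blast
  have "v = \<i> *\<^sub>C (gp + gm)"
    using v defect_difference_in_adjoint[OF g(1,2)] single_valued_adjoint_op[of T] T
    by (meson single_valuedD subsetD symmetric_op_def)
  moreover have "cinner v gp = cinner (gp - gm) (\<i> *\<^sub>C gp)"
    using g(1) v by (simp add: mem_defect_space_iff mem_adjoint_op_iff)
  ultimately have "2 * (\<i> * cinner gp gp) = 0"
    by (simp add: cinner_simps algebra_simps)
  then show False using g(3) by (simp add: cinner_self)
qed

lemma scaled_defect_difference_in_Domain_imp_zero:
  assumes T: "symmetric_op T"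
    and g: "gp \<in> defect_space T \<i>" "gm \<in> defect_space T (- \<i>)" "gp \<noteq> 0"
    and c: "c *\<^sub>C (gp - gm) \<in> Domain T"
  shows "c = 0"
proof (rule ccontr)
  assume "c \<noteq> 0"
  have "csubspace (Domain T)"
    using T by (intro csubspace_Domain) (simp add: symmetric_op_def linear_operator_def)
  from complex_vector.subspace_scale[OF this c, of "inverse c"] \<open>c \<noteq> 0\<close>
  have "gp - gm \<in> Domain T" by simp
  then show False using defect_difference_notin_Domain[OF T g] by blast
qed

text \<open>Restricting the adjoint of \<open>E\<close> to the enlarged domain adjoins only the pair \<open>(l, m)\<close>: the
  adjoint is single-valued, so on that domain it agrees with its restriction \<open>S\<close>.\<close>

lemma op_restrict_adjoint_eq_extension:
  assumes S: "csubspace S" "E \<subseteq> S" "S \<subseteq> adjoint_op E" and E: "densely_defined E"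
    and lm: "(l, m) \<in> S"
  shows "op_restrict (adjoint_op E) {x + y |x y. x \<in> Domain E \<and> y \<in> cspan {l}} =
    {e + c *\<^sub>C (l, m) |e c. e \<in> E}" (is "op_restrict _ ?D = ?T")
proof (intro equalityI subsetI)
  have T_S: "e + c *\<^sub>C (l, m) \<in> S" if "e \<in> E" for e c
    using that S(1,2) lm by (intro complex_vector.subspace_add complex_vector.subspace_scale) auto
  fix p
  {
    assume "p \<in> ?T"
    then obtain a b c where e: "(a, b) \<in> E" and p: "p = (a, b) + c *\<^sub>C (l, m)" by auto
    have "p \<in> adjoint_op E" unfolding p using T_S[OF e] S(3) by blast
    moreover have "fst p \<in> ?D"
      using e by (auto simp: p scaleC_prod_def complex_vector.span_singleton)
    ultimately show "p \<in> op_restrict (adjoint_op E) ?D"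
      by (cases p) (simp add: op_restrict_def)
  next
    assume "p \<in> op_restrict (adjoint_op E) ?D"
    then obtain a b c w where p: "p = (a + c *\<^sub>C l, w)" "p \<in> adjoint_op E" and e: "(a, b) \<in> E"
      by (auto simp: op_restrict_def complex_vector.span_singleton)
    have "(a + c *\<^sub>C l, b + c *\<^sub>C m) \<in> adjoint_op E"
      using T_S[OF e, of c] S(3) by (auto simp: scaleC_prod_def)
    then have "w = b + c *\<^sub>C m"
      using p single_valued_adjoint_op[OF E] by (metis single_valuedD)
    then have "p = (a, b) + c *\<^sub>C (l, m)" by (simp add: p(1) scaleC_prod_def)
    then show "p \<in> ?T" using e by blast
  }
qed

lemma csubspace_extension:
  assumes "csubspace E"
  shows "csubspace {e + c *\<^sub>C q |e c. e \<in> E}"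
proof -
  have "{e + c *\<^sub>C q |e c. e \<in> E} = {x + y |x y. x \<in> E \<and> y \<in> cspan {q}}"
    unfolding complex_vector.span_singleton by blast
  then show ?thesis
    using complex_vector.subspace_sums[OF assms complex_vector.subspace_span] by simp
qed

lemma symmetric_op_restriction:
  assumes S: "self_adjoint_op S" and T: "T \<subseteq> S" "csubspace T"
    and E: "densely_defined E" "E \<subseteq> T"
  shows "symmetric_op T"
  unfolding symmetric_op_def linear_operator_def
proof (intro conjI)
  show "single_valued T"
    using S T(1) by (auto simp: self_adjoint_op_def linear_operator_def intro: single_valued_subset)
  have "closure (Domain E) \<subseteq> closure (Domain T)"
    using E(2) by (intro closure_mono) blast
  then show "densely_defined T" using E(1) by (auto simp: densely_defined_def)
  have "S \<subseteq> adjoint_op T"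
    using S adjoint_op_antimono[OF T(1)] by (simp add: self_adjoint_op_def)
  then show "T \<subseteq> adjoint_op T" using T(1) by blast
qed (rule T(2))

section \<open>Coupling of two symmetric operators\<close>

text \<open>These are the combinations \<open>m + \<i> l\<close> and \<open>m - \<i> l\<close> for the pair \<open>(l, m)\<close> with
  \<open>l = r (x - y)\<close> and \<open>m = r \<i> (x + y)\<close>. They appear in the orthogonality conditions for the
  defect spaces at \<open>\<i>\<close> and \<open>- \<i>\<close>.\<close>

lemma scaled_sum_diff:
  fixes x y :: "'a::complex_inner"
  shows "r *\<^sub>C \<i> *\<^sub>C (x + y) + \<i> *\<^sub>C r *\<^sub>C (x - y) = (2 * \<i>) *\<^sub>C r *\<^sub>C x"
    and "r *\<^sub>C \<i> *\<^sub>C (x + y) - \<i> *\<^sub>C r *\<^sub>C (x - y) = (2 * \<i>) *\<^sub>C r *\<^sub>C y"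
proof -
  have double: "(2 * \<i>) *\<^sub>C r *\<^sub>C v = (\<i> * r) *\<^sub>C v + (\<i> * r) *\<^sub>C v" for v :: 'a
    by (simp only: scaleC_scaleC mult_2 distrib_right scaleC_add_left)
  show "r *\<^sub>C \<i> *\<^sub>C (x + y) + \<i> *\<^sub>C r *\<^sub>C (x - y) = (2 * \<i>) *\<^sub>C r *\<^sub>C x"
    and "r *\<^sub>C \<i> *\<^sub>C (x + y) - \<i> *\<^sub>C r *\<^sub>C (x - y) = (2 * \<i>) *\<^sub>C r *\<^sub>C y"
    unfolding double
    by (simp_all add: complex_vector.scale_right_diff_distrib scaleC_add_right mult.commute)
qed

theorem theorem4p1:
  fixes dA1 A1 :: "('a::chilbert_space \<times> 'a) set"
    and dA2 A2 :: "('b::chilbert_space \<times> 'b) set"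
    and gp1 gm1 :: 'a and gp2 gm2 :: 'b
    and \<alpha> :: real
    and L :: "('a \<times> 'b) set"
    and dA :: "(('a \<times> 'b) \<times> ('a \<times> 'b)) set"
  assumes "closed dA1" "symmetric_op dA1" "deficiency_indices dA1 = (1, 1)"
    and "closed dA2" "symmetric_op dA2" "deficiency_indices dA2 = (1, 1)"
    and "gp1 \<in> defect_space dA1 \<i>" "norm gp1 = 1"
    and "gm1 \<in> defect_space dA1 (- \<i>)" "norm gm1 = 1"
    and "gp2 \<in> defect_space dA2 \<i>" "norm gp2 = 1"
    and "gm2 \<in> defect_space dA2 (- \<i>)" "norm gm2 = 1"
    and "self_adjoint_op A1" "dA1 \<subseteq> A1" "gp1 - gm1 \<in> Domain A1"
    and "self_adjoint_op A2" "dA2 \<subseteq> A2" "gp2 - gm2 \<in> Domain A2"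
    and "\<alpha> \<in> {0..<pi}"
    and L_def: "L = cspan {(complex_of_real (sin \<alpha>) *\<^sub>C (gp1 - gm1),
                            complex_of_real (cos \<alpha>) *\<^sub>C (gp2 - gm2))}"
    and dA_def: "dA = op_restrict (adjoint_op (op_oplus dA1 dA2))
                        {x + l |x l. x \<in> Domain dA1 \<times> Domain dA2 \<and> l \<in> L}"
  shows "(Domain dA1 \<times> Domain dA2) \<inter> L = {0} \<and>
    symmetric_op dA \<and> deficiency_indices dA = (1, 1) \<and>
    self_adjoint_op (op_oplus A1 A2) \<and> dA \<subseteq> op_oplus A1 A2 \<and>
    (\<forall>z. Im z > 0 \<longrightarrow>
       weyl_titchmarsh dA (op_oplus A1 A2) z =
         complex_of_real ((cos \<alpha>)\<^sup>2) * weyl_titchmarsh dA1 A1 z +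
         complex_of_real ((sin \<alpha>)\<^sup>2) * weyl_titchmarsh dA2 A2 z)"
proof (intro conjI allI impI)
  define s c where "s = sin \<alpha>" and "c = cos \<alpha>"
  define d1 d2 where "d1 = gp1 - gm1" and "d2 = gp2 - gm2"
  define E where "E = op_oplus dA1 dA2"
  define S where "S = op_oplus A1 A2"
  define l where "l = (complex_of_real s *\<^sub>C d1, complex_of_real c *\<^sub>C d2)"
  define m where "m = (complex_of_real s *\<^sub>C \<i> *\<^sub>C (gp1 + gm1),
    complex_of_real c *\<^sub>C \<i> *\<^sub>C (gp2 + gm2))"
  have sc: "s\<^sup>2 + c\<^sup>2 = 1" by (simp add: s_def c_def)
  have L: "L = cspan {l}" by (simp add: L_def l_def d1_def d2_def s_def c_def)
  have lin: "csubspace dA1" "csubspace dA2" "linear_operator A1" "linear_operator A2"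
    and dense: "densely_defined dA1" "densely_defined dA2"
    using assms by (auto simp: symmetric_op_def self_adjoint_op_def linear_operator_def)
  have linE: "csubspace E"
    unfolding E_def using linear_operator_op_oplus assms(2,5)
    by (auto simp: symmetric_op_def linear_operator_def)
  have denseE: "densely_defined E"
    unfolding E_def by (rule densely_defined_op_oplus[OF dense])
  have "self_adjoint_op S"
    unfolding S_def by (intro self_adjoint_op_oplus assms)
  then show "self_adjoint_op (op_oplus A1 A2)" by (simp add: S_def)
  have linS: "csubspace S"
    using \<open>self_adjoint_op S\<close> by (simp add: self_adjoint_op_def linear_operator_def)
  have ES: "E \<subseteq> S" unfolding E_def S_def by (intro op_oplus_mono assms)
  then have SE: "S \<subseteq> adjoint_op E"
    using adjoint_op_antimono \<open>self_adjoint_op S\<close> by (metis self_adjoint_op_def)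
  have d: "(d1, \<i> *\<^sub>C (gp1 + gm1)) \<in> A1" "(d2, \<i> *\<^sub>C (gp2 + gm2)) \<in> A2"
    unfolding d1_def d2_def
    by (rule defect_difference_in_extension[OF assms(15,16) dense(1) assms(7,9,17)]
        defect_difference_in_extension[OF assms(18,19) dense(2) assms(11,13,20)])+
  then have lm: "(l, m) \<in> S"
    using lin(3,4) unfolding l_def m_def S_def mem_op_oplus_iff linear_operator_def
    by (blast intro: csubspace_pairs(3))
  have dA: "dA = {e + t *\<^sub>C (l, m) |e t. e \<in> E}"
    unfolding dA_def L using op_restrict_adjoint_eq_extension[OF linS ES SE denseE lm]
    by (simp add: E_def Domain_op_oplus)
  have dA_S: "dA \<subseteq> S"
    unfolding dA using linS ES lm
    by (auto intro!: complex_vector.subspace_add complex_vector.subspace_scale)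
  then show "dA \<subseteq> op_oplus A1 A2" by (simp add: S_def)
  have E_dA: "E \<subseteq> dA"
  proof
    fix e assume "e \<in> E"
    moreover have "e = e + 0 *\<^sub>C (l, m)" by simp
    ultimately show "e \<in> dA" unfolding dA by blast
  qed
  show "symmetric_op dA"
    using symmetric_op_restriction[OF \<open>self_adjoint_op S\<close> dA_S _ denseE E_dA]
      csubspace_extension[OF linE] by (simp add: dA)

  show "(Domain dA1 \<times> Domain dA2) \<inter> L = {0}"
  proof (intro equalityI subsetI)
    fix p assume p: "p \<in> (Domain dA1 \<times> Domain dA2) \<inter> L"
    then obtain t where t: "p = t *\<^sub>C l" by (auto simp: L complex_vector.span_singleton)
    have "(t * s) *\<^sub>C d1 \<in> Domain dA1" "(t * c) *\<^sub>C d2 \<in> Domain dA2"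
      using p by (auto simp: t l_def scaleC_prod_def scaleC_scaleC)
    moreover have "gp1 \<noteq> 0" "gp2 \<noteq> 0" using assms by auto
    ultimately have "t * s = 0" "t * c = 0"
      using scaled_defect_difference_in_Domain_imp_zero[OF assms(2,7,9)]
        scaled_defect_difference_in_Domain_imp_zero[OF assms(5,11,13)]
      unfolding d1_def d2_def by blast+
    then have "t = 0" using sc by auto
    then show "p \<in> {0}" by (simp add: t)
  next
    have "csubspace (Domain E)" "csubspace L"
      using csubspace_Domain[OF linE] by (simp_all add: L)
    then show "p \<in> (Domain dA1 \<times> Domain dA2) \<inter> L" if "p \<in> {0}" for p
      using that complex_vector.subspace_0 by (auto simp: E_def Domain_op_oplus[symmetric])
  qed

  have defect: "defect_space dA z =
      cspan {(complex_of_real c *\<^sub>C g1, - (complex_of_real s *\<^sub>C g2))}"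
    if g: "defect_space dA1 z = cspan {g1}" "defect_space dA2 z = cspan {g2}"
      "norm g1 = 1" "norm g2 = 1"
      and ml: "m - cnj z *\<^sub>C l = (2 * \<i>) *\<^sub>C (complex_of_real s *\<^sub>C g1, complex_of_real c *\<^sub>C g2)"
    for z g1 g2
    unfolding dA defect_space_extension[OF linE] ml cinner_scaleC_left
    using orthogonal_in_plane[OF g(3,4) sc] defect_space_op_oplus[OF lin(1,2), of z]
    by (simp add: E_def g)
  \<comment> \<open>The two cases differ only in the defect vectors: \<open>m + \<i> l\<close> and \<open>m - \<i> l\<close> retain the
    \<open>gp\<close> and the \<open>gm\<close> parts of \<open>l\<close>, respectively.\<close>
  have gp: "defect_space dA1 \<i> = cspan {gp1}" "defect_space dA2 \<i> = cspan {gp2}"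
    and gm: "defect_space dA1 (- \<i>) = cspan {gm1}" "defect_space dA2 (- \<i>) = cspan {gm2}"
    using defect_space_eq_cspan[OF assms(3,8,7)] defect_space_eq_cspan[OF assms(6,12,11)]
      defect_space_eq_cspan[OF assms(3,10,9)] defect_space_eq_cspan[OF assms(6,14,13)] by simp_all
  have "m - cnj \<i> *\<^sub>C l = (2 * \<i>) *\<^sub>C (complex_of_real s *\<^sub>C gp1, complex_of_real c *\<^sub>C gp2)"
    by (simp add: m_def l_def d1_def d2_def scaleC_prod_def scaled_sum_diff
        complex_vector.scale_minus_left del: complex_vector.scale_scale)
  note defect_p = defect[OF gp assms(8,12) this]
  have "m - cnj (- \<i>) *\<^sub>C l = (2 * \<i>) *\<^sub>C (complex_of_real s *\<^sub>C gm1, complex_of_real c *\<^sub>C gm2)"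
    by (simp add: m_def l_def d1_def d2_def scaleC_prod_def scaled_sum_diff
        complex_vector.scale_minus_left del: complex_vector.scale_scale)
  note defect_m = defect[OF gm assms(10,14) this]
  have norm_h: "norm (complex_of_real c *\<^sub>C g1, - (complex_of_real s *\<^sub>C g2)) = 1"
    if "norm g1 = 1" "norm g2 = 1" for g1 :: 'a and g2 :: 'b
    using that sc by (simp add: norm_Pair norm_scaleC add.commute)
  have nz: "(complex_of_real c *\<^sub>C g1, - (complex_of_real s *\<^sub>C g2)) \<noteq> 0"
    if "norm g1 = 1" "norm g2 = 1" for g1 :: 'a and g2 :: 'b
    using norm_h[OF that] by auto
  show "deficiency_indices dA = (1, 1)"
    unfolding deficiency_indices_def defect_p defect_m
    using cdim_cspan_singleton nz assms(8,10,12,14) by blast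

  fix z :: complex assume "Im z > 0"
  then have z: "Im z \<noteq> 0" by simp
  obtain k1 where k1: "(gp1, k1) \<in> weyl_operator A1 z"
    using weyl_operator_total[OF assms(15) z] .
  obtain k2 where k2: "(gp2, k2) \<in> weyl_operator A2 z"
    using weyl_operator_total[OF assms(18) z] .
  have "((complex_of_real c *\<^sub>C gp1, complex_of_real (- s) *\<^sub>C gp2),
      (complex_of_real c *\<^sub>C k1, complex_of_real (- s) *\<^sub>C k2)) \<in> weyl_operator S z"
    unfolding S_def using lin(3,4)
    by (intro weyl_operator_op_oplus weyl_operator_scaleC k1 k2)
       (auto simp: linear_operator_def)
  then have "((complex_of_real c *\<^sub>C gp1, - (complex_of_real s *\<^sub>C gp2)),
      (complex_of_real c *\<^sub>C k1, - (complex_of_real s *\<^sub>C k2))) \<in> weyl_operator S z"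
    by (simp add: complex_vector.scale_minus_left)
  from weyl_titchmarsh_eq[OF \<open>self_adjoint_op S\<close> z defect_p norm_h[OF assms(8,12)] this]
  have "weyl_titchmarsh dA S z =
      complex_of_real (c\<^sup>2) * cinner k1 gp1 + complex_of_real (s\<^sup>2) * cinner k2 gp2"
    by (simp add: cinner_prod_def cinner_simps power2_eq_square)
  also have "cinner k1 gp1 = weyl_titchmarsh dA1 A1 z"
    using weyl_titchmarsh_eq[OF assms(15) z gp(1) assms(8) k1] by simp
  also have "cinner k2 gp2 = weyl_titchmarsh dA2 A2 z"
    using weyl_titchmarsh_eq[OF assms(18) z gp(2) assms(12) k2] by simp
  finally show "weyl_titchmarsh dA (op_oplus A1 A2) z =
      complex_of_real ((cos \<alpha>)\<^sup>2) * weyl_titchmarsh dA1 A1 z +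
      complex_of_real ((sin \<alpha>)\<^sup>2) * weyl_titchmarsh dA2 A2 z"
    by (simp add: S_def s_def c_def)
qed

end
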